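(* Let $(P_n(x))_{n\in\mathbb{N}_0}$ be a random walk polynomial sequence with recurrence coefficients $(c_n)_{n\in\mathbb{N}}\subseteq(0,1)$ and orthogonalization measure $\mu$. If $k\in\mathbb{N}$, then the following are equivalent: (i) $(P_n(x))_{n\in\mathbb{N}_0}$ is $k$-sieved, (ii) for each $n\in\mathbb{N}_0$, $P_n(x)$ is an eigenvector of $\mathrm{A}_k$, (iii) $\alpha_{n+1}(n-1;k)=0$ for all $n\in\mathbb{N}$. If these equivalent conditions are satisfied, then $P_n\left(\left|\cos\left(\frac{\pi}{k}\right)\right|\right)=T_n\left(\left|\cos\left(\frac{\pi}{k}\right)\right|\right)$ is the eigenvalue of $\mathrm{A}_k$ which corresponds to the eigenvector $P_n(x)$, for every $n\in\mathbb{N}_0$.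
   Context: $\mathbb{N}=\{1,2,\ldots\}$, $\mathbb{N}_0=\mathbb{N}\cup\{0\}$. An orthogonalization measure is a symmetric probability Borel measure $\mu$ on $\mathbb{R}$ with $|\mathsf{supp}\,\mu|=\infty$ and $\mathsf{supp}\,\mu\subseteq[-1,1]$. The random walk polynomial sequence (RWPS) with respect to $\mu$ is the sequence $(P_n(x))_{n\in\mathbb{N}_0}\subseteq\mathbb{R}[x]$ ($\deg P_n=n$) of polynomials orthogonal with respect to $\mu$, normalized by $P_n(1)=1$, $n\in\mathbb{N}_0$. It is well known that RWPS are exactly the sequences given by $P_0(x)=1$ and $xP_n(x)=a_nP_{n+1}(x)+c_nP_{n-1}(x)$, $n\in\mathbb{N}_0$, with $c_0:=0$, $(c_n)_{n\in\mathbb{N}}\subseteq(0,1)$ and $a_n:=1-c_n$, $n\in\mathbb{N}_0$ (the term $c_0P_{-1}(x)$ is read as $0$), and that the orthogonalization measure $\mu$ is uniquely determined by the RWPS. An RWPS $(P_n(x))_{n\in\mathbb{N}_0}$ is called $k$-sieved if $c_n=\frac12$ for every $n\in\mathbb{N}$ with $k\nmid n$ (equivalently, there is an RWPS with recurrence coefficients $(\tilde c_n)_{n\in\mathbb{N}}\subseteq(0,1)$ such that $c_n=\tilde c_{n/k}$ if $k\mid n$ and $c_n=\frac12$ otherwise). $(T_n(x))_{n\in\mathbb{N}_0}$ are the Chebyshev polynomials of the first kind, $T_n(\cos\theta)=\cos(n\theta)$. The sieved averaging operator $\mathrm{A}_k\colon\mathbb{R}[x]\to\mathbb{R}[x]$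 is the linear operator determined by $\mathrm{A}_kT_n(x)=T_n\left(\left|\cos\left(\frac{\pi}{k}\right)\right|\right)T_n(x)$, $n\in\mathbb{N}_0$. For $n,j\in\mathbb{N}_0$, $\alpha_n(j;k):=\int_{\mathbb{R}}\mathrm{A}_kP_n(x)\,P_j(x)\,\mathrm{d}\mu(x)$. *)

theory Defs
  imports "HOL-Probability.Probability" "HOL-Computational_Algebra.Polynomial"
begin

definition measure_support :: "'a::topological_space measure \<Rightarrow> 'a set" where
  "measure_support \<mu> = {x. \<forall>U. open U \<longrightarrow> x \<in> U \<longrightarrow> emeasure \<mu> U > 0}"

definition orthogonalization_measure :: "real measure \<Rightarrow> bool" where
  "orthogonalization_measure \<mu> \<longleftrightarrow>
     prob_space \<mu> \<and> sets \<mu> = sets borel \<and> distr \<mu> borel uminus = \<mu> \<and>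
     infinite (measure_support \<mu>) \<and> measure_support \<mu> \<subseteq> {-1..1}"

text \<open>The supports are bounded, so all the Bochner integrals below exist; in particular a value
  \<open>0\<close> never stems from a lack of integrability.\<close>

definition random_walk_polys :: "real measure \<Rightarrow> (nat \<Rightarrow> real poly) \<Rightarrow> bool" where
  "random_walk_polys \<mu> P \<longleftrightarrow>
     orthogonalization_measure \<mu> \<and>
     (\<forall>n. degree (P n) = n) \<and>
     (\<forall>m n. m \<noteq> n \<longrightarrow> (LINT x|\<mu>. poly (P m) x * poly (P n) x) = 0) \<and>
     (\<forall>n. poly (P n) 1 = 1)"

text \<open>For \<open>n = 0\<close> the truncated index \<open>n - 1\<close> is harmless, since \<open>c 0 = 0\<close>.\<close>

definition recurrence_coeffs :: "(nat \<Rightarrow> real poly) \<Rightarrow> (nat \<Rightarrow> real) \<Rightarrow> bool" where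
  "recurrence_coeffs P c \<longleftrightarrow>
     c 0 = 0 \<and> (\<forall>n\<ge>1. c n \<in> {0<..<1}) \<and> P 0 = 1 \<and>
     (\<forall>n. [:0, 1:] * P n = smult (1 - c n) (P (n + 1)) + smult (c n) (P (n - 1)))"

text \<open>Being \<open>k\<close>-sieved is expressed on the recurrence coefficients, which the sequence
  determines uniquely.\<close>

definition k_sieved :: "nat \<Rightarrow> (nat \<Rightarrow> real) \<Rightarrow> bool" where
  "k_sieved k c \<longleftrightarrow> (\<forall>n\<ge>1. \<not> k dvd n \<longrightarrow> c n = 1 / 2)"

definition chebyshev_T :: "nat \<Rightarrow> real poly" where
  "chebyshev_T n = (THE p. \<forall>\<theta>. poly p (cos \<theta>) = cos (real n * \<theta>))"

definition cos_pt :: "nat \<Rightarrow> real" where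
  "cos_pt k = \<bar>cos (pi / real k)\<bar>"

definition sieved_averaging :: "nat \<Rightarrow> real poly \<Rightarrow> real poly" where
  "sieved_averaging k =
     (THE A. Vector_Spaces.linear smult smult A \<and>
        (\<forall>n. A (chebyshev_T n) = smult (poly (chebyshev_T n) (cos_pt k)) (chebyshev_T n)))"

definition eigenpair :: "(real poly \<Rightarrow> real poly) \<Rightarrow> real \<Rightarrow> real poly \<Rightarrow> bool" where
  "eigenpair A l p \<longleftrightarrow> p \<noteq> 0 \<and> A p = smult l p"

definition alpha :: "real measure \<Rightarrow> (nat \<Rightarrow> real poly) \<Rightarrow> nat \<Rightarrow> nat \<Rightarrow> nat \<Rightarrow> real" where
  "alpha \<mu> P k n j = (LINT x|\<mu>. poly (sieved_averaging k (P n)) x * poly (P j) x)"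

text \<open>The two definite descriptions above are well defined.\<close>

lemma poly_eqI_cos:
  fixes p q :: "real poly"
  assumes "\<And>\<theta>. poly p (cos \<theta>) = poly q (cos \<theta>)"
  shows "p = q"
proof (rule ccontr)
  assume "p \<noteq> q"
  then have "finite {x. poly (p - q) x = 0}"
    by (intro poly_roots_finite) auto
  moreover have "{-1..1} \<subseteq> {x. poly (p - q) x = 0}"
  proof
    fix x :: real assume "x \<in> {-1..1}"
    then have "cos (arccos x) = x" by simp
    with assms[of "arccos x"] show "x \<in> {x. poly (p - q) x = 0}" by simp
  qed
  ultimately have "finite {-1..1::real}" by (rule finite_subset[rotated])
  then show False by (simp add: infinite_Icc)
qed

lemma cos_Suc_Suc: "cos (real (Suc (Suc n)) * t) = 2 * cos t * cos (real (Suc n) * t) - cos (real n * t)"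
proof -
  have "cos (real (Suc n) * t + t) + cos (real (Suc n) * t - t) = 2 * cos t * cos (real (Suc n) * t)"
    by (simp add: cos_add cos_diff)
  then show ?thesis by (simp add: algebra_simps)
qed

lemma chebyshev_T_exists: "\<exists>p::real poly. \<forall>\<theta>. poly p (cos \<theta>) = cos (real n * \<theta>)"
proof (induction n rule: less_induct)
  case (less n)
  consider "n = 0" | "n = 1" | m where "n = Suc (Suc m)"
    by (metis One_nat_def old.nat.exhaust)
  then show ?case
  proof cases
    case 1
    then show ?thesis by (intro exI[of _ 1]) auto
  next
    case 2
    then show ?thesis by (intro exI[of _ "[:0, 1:]"]) auto
  next
    case (3 m)
    obtain p q :: "real poly" where "\<forall>\<theta>. poly p (cos \<theta>) = cos (real m * \<theta>)"
      and "\<forall>\<theta>. poly q (cos \<theta>) = cos (real (Suc m) * \<theta>)"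
      using less[of m] less[of "Suc m"] 3 by auto
    then show ?thesis unfolding 3 cos_Suc_Suc
      by (intro exI[of _ "[:0, 2:] * q - p"]) (auto simp del: of_nat_Suc)
  qed
qed

lemma chebyshev_T_cos: "poly (chebyshev_T n) (cos \<theta>) = cos (real n * \<theta>)"
proof -
  have "\<exists>!p::real poly. \<forall>\<theta>. poly p (cos \<theta>) = cos (real n * \<theta>)"
    using chebyshev_T_exists[of n] by (metis poly_eqI_cos)
  from theI'[OF this] show ?thesis unfolding chebyshev_T_def by blast
qed

lemma chebyshev_T_rec:
  "chebyshev_T 0 = 1" "chebyshev_T (Suc 0) = [:0, 1:]"
  "chebyshev_T (Suc (Suc n)) = [:0, 2:] * chebyshev_T (Suc n) - chebyshev_T n"
proof -
  show "chebyshev_T (Suc (Suc n)) = [:0, 2:] * chebyshev_T (Suc n) - chebyshev_T n"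
    by (rule poly_eqI_cos) (simp add: chebyshev_T_cos cos_Suc_Suc del: of_nat_Suc)
qed (rule poly_eqI_cos, simp add: chebyshev_T_cos)+

lemma degree_chebyshev_T: "degree (chebyshev_T n) = n"
proof (induction n rule: less_induct)
  case (less n)
  consider "n = 0" | "n = 1" | m where "n = Suc (Suc m)"
    by (metis One_nat_def old.nat.exhaust)
  then show ?case
  proof cases
    case (3 m)
    have d: "degree (chebyshev_T m) = m" "degree (chebyshev_T (Suc m)) = Suc m"
      using less 3 by auto
    then have "chebyshev_T (Suc m) \<noteq> 0" by force
    then have e: "degree ([:0, 2:] * chebyshev_T (Suc m)) = Suc (Suc m)"
      by (subst degree_mult_eq) (auto simp: d)
    show ?thesis unfolding 3 chebyshev_T_rec(3)
      using e d degree_add_eq_left[of "- chebyshev_T m" "[:0, 2:] * chebyshev_T (Suc m)"] by simp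
  qed (auto simp: chebyshev_T_rec)
qed

lemma chebyshev_T_nonzero: "chebyshev_T n \<noteq> 0"
  using chebyshev_T_cos[of n 0] by auto

interpretation real_poly: vector_space "smult :: real \<Rightarrow> real poly \<Rightarrow> real poly"
  by unfold_locales (auto simp: smult_add_right smult_add_left)

interpretation real_poly_pair: vector_space_pair
  "smult :: real \<Rightarrow> real poly \<Rightarrow> real poly" "smult :: real \<Rightarrow> real poly \<Rightarrow> real poly"
  by unfold_locales

lemma independent_chebyshev_T: "real_poly.independent (range chebyshev_T)"
proof
  assume "real_poly.dependent (range chebyshev_T)"
  then obtain t u where t: "finite t" "t \<subseteq> range chebyshev_T" "(\<Sum>v\<in>t. smult (u v) v) = 0"
    and ne: "\<exists>v\<in>t. u v \<noteq> 0"
    unfolding real_poly.dependent_explicit by blast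
  define S where "S = {v\<in>t. u v \<noteq> 0}"
  have "finite S" "S \<noteq> {}" using t ne by (auto simp: S_def)
  then have "Max (degree ` S) \<in> degree ` S" by simp
  then obtain v where v: "v \<in> S" "degree v = Max (degree ` S)" by (metis imageE)
  have max: "degree w \<le> degree v" if "w \<in> S" for w
    using that \<open>finite S\<close> v(2) by simp
  have z: "u w * coeff w (degree v) = 0" if w: "w \<in> t - {v}" for w
  proof (cases "u w = 0")
    case False
    then have "degree w \<le> degree v" using max w by (simp add: S_def)
    moreover have "degree w \<noteq> degree v"
    proof -
      have "w \<in> range chebyshev_T" "v \<in> range chebyshev_T" "w \<noteq> v"
        using w t(2) v(1) unfolding S_def by blast+
      then show ?thesis by (metis degree_chebyshev_T rangeE)
    qed
    ultimately show ?thesis by (simp add: coeff_eq_0)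
  qed simp
  have vt: "v \<in> t" using v(1) by (simp add: S_def)
  have "0 = coeff (\<Sum>v\<in>t. smult (u v) v) (degree v)" using t(3) by simp
  also have "\<dots> = (\<Sum>w\<in>t. u w * coeff w (degree v))" by (simp add: coeff_sum)
  also have "\<dots> = u v * lead_coeff v"
    using z by (subst sum.remove[OF t(1) vt]) (simp add: sum.neutral)
  finally have "v = 0" using v(1) by (simp add: S_def)
  then show False using vt t(2) chebyshev_T_nonzero by auto
qed

lemma span_chebyshev_T: "real_poly.span (range chebyshev_T) = UNIV"
proof -
  have "p \<in> real_poly.span (range chebyshev_T)" if "degree p < n" for p n
    using that
  proof (induction n arbitrary: p)
    case (Suc n)
    define q where "q = smult (coeff p n / lead_coeff (chebyshev_T n)) (chebyshev_T n)"
    have q: "q \<in> real_poly.span (range chebyshev_T)"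
      unfolding q_def by (intro real_poly.span_scale real_poly.span_base) auto
    have lc: "coeff (chebyshev_T n) n \<noteq> 0"
      using chebyshev_T_nonzero[of n] degree_chebyshev_T[of n] by (metis leading_coeff_0_iff)
    have c: "coeff (p - q) i = 0" if "i \<ge> n" for i
    proof (cases "i = n")
      case True
      then show ?thesis using lc by (simp add: q_def degree_chebyshev_T)
    next
      case False
      then show ?thesis using that Suc.prems
        by (simp add: q_def coeff_eq_0 degree_chebyshev_T)
    qed
    have "p - q \<in> real_poly.span (range chebyshev_T)"
    proof (cases "n = 0")
      case True
      then have "p - q = 0" using c by (intro poly_eqI) simp
      then show ?thesis by (simp add: real_poly.span_zero)
    next
      case False
      have "degree (p - q) \<le> n - 1" using c by (intro degree_le) auto
      then show ?thesis using False by (intro Suc.IH) linarith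
    qed
    from real_poly.span_add[OF this q] show ?case by simp
  qed simp
  then show ?thesis by blast
qed

lemma sieved_averaging:
  shows linear_sieved_averaging: "Vector_Spaces.linear smult smult (sieved_averaging k)"
    and sieved_averaging_chebyshev_T:
      "sieved_averaging k (chebyshev_T n) =
         smult (poly (chebyshev_T n) (cos_pt k)) (chebyshev_T n)"
proof -
  let ?Q = "\<lambda>A. Vector_Spaces.linear smult smult A \<and>
        (\<forall>n. A (chebyshev_T n) = smult (poly (chebyshev_T n) (cos_pt k)) (chebyshev_T n))"
  obtain A where A: "Vector_Spaces.linear smult smult A"
    "\<forall>v\<in>range chebyshev_T. A v = smult (poly v (cos_pt k)) v"
    using real_poly_pair.linear_independent_extend[OF independent_chebyshev_T,
        of "\<lambda>v. smult (poly v (cos_pt k)) v"] by metis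
  have "\<exists>!A. ?Q A"
  proof (rule ex_ex1I)
    show "\<exists>A. ?Q A" using A by blast
    fix A B assume "?Q A" "?Q B"
    then show "A = B"
      using real_poly_pair.linear_eq_on[of A B _ "range chebyshev_T"] span_chebyshev_T by fastforce
  qed
  from theI'[OF this]
  show "Vector_Spaces.linear smult smult (sieved_averaging k)"
    "sieved_averaging k (chebyshev_T n) =
         smult (poly (chebyshev_T n) (cos_pt k)) (chebyshev_T n)"
    unfolding sieved_averaging_def by blast+
qed

end

theory Submission
  imports Defs
begin

text \<open>
  Write \<open>\<phi> = \<pi> / k\<close>. For \<open>k \<ge> 2\<close> the operator \<open>A\<^sub>k\<close> averages over two shifts of the angle:
  \<open>(A\<^sub>k p)(cos \<theta>)\<close> is the mean of \<open>p (cos (\<theta> + \<phi>))\<close> and \<open>p (cos (\<theta> - \<phi>))\<close>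
  (\<open>sieved_averaging_shift\<close>); for \<open>k = 1\<close> it is the identity, and every sequence is
  \<open>1\<close>-sieved.

  \<^emph>\<open>Sieved sequences consist of eigenvectors.\<close> Where \<open>c\<^sub>n = 1/2\<close>, the recurrence is that of
  \<open>cos (n \<theta>)\<close> and \<open>sin (n \<theta>)\<close>. So on every block \<open>m k \<le> n \<le> (m + 1) k\<close> one has
  \<open>P\<^sub>n (cos \<theta>) = u \<theta> * cos (j \<theta>) + v \<theta> * sin (j \<theta>)\<close> with \<open>n = m k + j\<close> and \<open>u\<close>, \<open>v\<close> independent
  of \<open>j\<close>. Passing to the next block multiplies the vector \<open>(u, v)\<close> by a matrix whose entries are
  multiples of \<open>cos (k \<theta>)\<close> and \<open>sin (k \<theta>)\<close>, and these change sign under \<open>\<theta> \<mapsto> \<theta> + \<phi>\<close>.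
  Hence \<open>u\<close> and \<open>v\<close> are multiplied by \<open>(-1) ^ m\<close> under that shift (\<open>sieved_block\<close>), and averaging
  the two shifts multiplies \<open>P\<^sub>n\<close> by \<open>(-1) ^ m * cos (j \<phi>)\<close>.

  \<^emph>\<open>Eigenvectors give vanishing integrals\<close> by orthogonality.

  \<^emph>\<open>Vanishing integrals force sievedness.\<close> Expand
  \<open>P\<^sub>n\<^sub>+\<^sub>1 = p (T\<^sub>n\<^sub>+\<^sub>1 + b T\<^sub>n\<^sub>-\<^sub>1) + lower terms\<close> with \<open>p \<noteq> 0\<close>. As \<open>A\<^sub>k\<close> is diagonal in the Chebyshev
  basis, \<open>\<alpha>\<^sub>n\<^sub>+\<^sub>1(n - 1; k)\<close> is a nonzero multiple of \<open>b * sin (n \<phi>) * sin \<phi>\<close> (\<open>alpha_expansion\<close>), so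
  \<open>b = 0\<close> unless \<open>k\<close> divides \<open>n\<close>. The three-term recurrence (\<open>chebyshev_expansion_step\<close>) turns
  this, by induction, into \<open>b = 1 - 2 c\<^sub>n\<close> for every \<open>n\<close>, whence \<open>c\<^sub>n = 1/2\<close> unless \<open>k\<close> divides \<open>n\<close>.

  The eigenvalue is identified in two ways: evaluation at \<open>1\<close> satisfies
  \<open>(A\<^sub>k p)(1) = p \<bar>cos \<phi>\<bar>\<close>, and \<open>A\<^sub>k\<close> multiplies the leading coefficient of a polynomial
  of degree \<open>n\<close> by \<open>T\<^sub>n \<bar>cos \<phi>\<bar>\<close>.
\<close>

section \<open>Polynomials of bounded degree\<close>

text \<open>The bound on the degree is strict, so that the set for \<open>0\<close> is the zero space; this is what
  makes the expansions below meaningful down to the smallest indices.\<close>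

definition polys_below :: "nat \<Rightarrow> real poly set" where
  "polys_below m = {p. \<forall>i\<ge>m. coeff p i = 0}"

lemma polys_below_0: "p \<in> polys_below 0 \<longleftrightarrow> p = 0"
  by (auto simp: polys_below_def poly_eq_iff)

lemma polys_below_mono: "p \<in> polys_below m \<Longrightarrow> m \<le> n \<Longrightarrow> p \<in> polys_below n"
  by (auto simp: polys_below_def)

lemma zero_in_polys_below: "0 \<in> polys_below m"
  by (simp add: polys_below_def)

lemma polys_below_add: "p \<in> polys_below m \<Longrightarrow> q \<in> polys_below m \<Longrightarrow> p + q \<in> polys_below m"
  by (simp add: polys_below_def)

lemma polys_below_diff: "p \<in> polys_below m \<Longrightarrow> q \<in> polys_below m \<Longrightarrow> p - q \<in> polys_below m"
  by (simp add: polys_below_def)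

lemma polys_below_smult: "p \<in> polys_below m \<Longrightarrow> smult s p \<in> polys_below m"
  by (simp add: polys_below_def)

lemma polys_below_degree: "degree p < m \<Longrightarrow> p \<in> polys_below m"
  by (simp add: polys_below_def coeff_eq_0)

lemma polys_below_mult_x: "p \<in> polys_below m \<Longrightarrow> [:0, 1:] * p \<in> polys_below (Suc m)"
  by (auto simp: polys_below_def coeff_pCons split: nat.split)

lemma polys_below_lead:
  assumes "p \<in> polys_below (Suc m)" "degree B = m" "coeff B m \<noteq> 0"
  shows "p - smult (coeff p m / coeff B m) B \<in> polys_below m"
  unfolding polys_below_def
proof safe
  fix i assume "m \<le> i"
  then show "coeff (p - smult (coeff p m / coeff B m) B) i = 0"
    using assms by (cases "i = m") (auto simp: polys_below_def coeff_eq_0)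
qed

text \<open>A linear property that holds for one polynomial of each degree holds for all polynomials.\<close>

lemma polys_below_induct [consumes 1, case_names degree lead zero add smult basis]:
  fixes B :: "nat \<Rightarrow> real poly"
  assumes "p \<in> polys_below m"
    and deg: "\<And>j. degree (B j) = j" and lead: "\<And>j. coeff (B j) j \<noteq> 0"
    and "Q 0" and add: "\<And>p q. Q p \<Longrightarrow> Q q \<Longrightarrow> Q (p + q)"
    and smult: "\<And>s p. Q p \<Longrightarrow> Q (smult s p)"
    and basis: "\<And>j. j < m \<Longrightarrow> Q (B j)"
  shows "Q p"
  using assms(1) basis
proof (induction m arbitrary: p)
  case 0
  then show ?case using \<open>Q 0\<close> by (simp add: polys_below_0)
next
  case (Suc m)
  let ?q = "smult (coeff p m / coeff (B m) m) (B m)"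
  have "Q (p - ?q)"
    using Suc polys_below_lead[OF Suc.prems(1) deg lead] by auto
  moreover have "Q ?q" using Suc.prems(2) by (intro smult) auto
  ultimately have "Q (p - ?q + ?q)" by (rule add)
  then show ?case by simp
qed

lemma coeff_chebyshev_T: "coeff (chebyshev_T n) n \<noteq> 0"
  using chebyshev_T_nonzero[of n] degree_chebyshev_T[of n] by (metis leading_coeff_0_iff)

lemma chebyshev_T_polys_below: "n < m \<Longrightarrow> chebyshev_T n \<in> polys_below m"
  by (simp add: polys_below_degree degree_chebyshev_T)

lemma mult_x_chebyshev_T:
  "[:0, 1:] * chebyshev_T (Suc n) = smult (1/2) (chebyshev_T (n + 2) + chebyshev_T n)"
  by (simp add: chebyshev_T_rec)

section \<open>The sieved averaging operator\<close>

lemma sieved_averaging_add: "sieved_averaging k (p + q) = sieved_averaging k p + sieved_averaging k q"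
proof -
  interpret Vector_Spaces.linear smult smult "sieved_averaging k" by (rule linear_sieved_averaging)
  show ?thesis by (rule add)
qed

lemma sieved_averaging_smult: "sieved_averaging k (smult s p) = smult s (sieved_averaging k p)"
proof -
  interpret Vector_Spaces.linear smult smult "sieved_averaging k" by (rule linear_sieved_averaging)
  show ?thesis by (rule scale)
qed

lemma sieved_averaging_0: "sieved_averaging k 0 = 0"
  using sieved_averaging_smult[of k 0 0] by simp

lemma poly_chebyshev_induct [case_names zero add smult chebyshev]:
  fixes p :: "real poly"
  assumes "Q 0" "\<And>p q. Q p \<Longrightarrow> Q q \<Longrightarrow> Q (p + q)" "\<And>s p. Q p \<Longrightarrow> Q (smult s p)"
    "\<And>j. Q (chebyshev_T j)"
  shows "Q p"
  by (rule polys_below_induct[of p "Suc (degree p)" chebyshev_T Q])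
    (use assms in \<open>auto simp: polys_below_degree degree_chebyshev_T coeff_chebyshev_T\<close>)

lemma sieved_averaging_polys_below:
  assumes "p \<in> polys_below m"
  shows "sieved_averaging k p \<in> polys_below m"
  using assms
  by (induction rule: polys_below_induct[where B = chebyshev_T])
    (auto simp: degree_chebyshev_T coeff_chebyshev_T sieved_averaging_0 sieved_averaging_add
      sieved_averaging_smult sieved_averaging_chebyshev_T zero_in_polys_below
      intro!: polys_below_add polys_below_smult chebyshev_T_polys_below)

text \<open>\<open>A\<^sub>k\<close> is triangular with respect to the degree; its diagonal entries are the values of
  the Chebyshev polynomials.\<close>

lemma coeff_sieved_averaging:
  assumes "degree p = n"
  shows "coeff (sieved_averaging k p) n = poly (chebyshev_T n) (cos_pt k) * coeff p n"
proof -
  let ?T = "chebyshev_T n"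
  define s where "s = coeff p n / coeff ?T n"
  define r where "r = p - smult s ?T"
  have "r \<in> polys_below n"
    unfolding r_def s_def using assms
    by (intro polys_below_lead) (auto simp: polys_below_degree degree_chebyshev_T coeff_chebyshev_T)
  then have "coeff (sieved_averaging k r) n = 0"
    using sieved_averaging_polys_below by (auto simp: polys_below_def)
  moreover have "p = r + smult s ?T" by (simp add: r_def)
  then have "sieved_averaging k p
      = sieved_averaging k r + smult (s * poly ?T (cos_pt k)) ?T"
    by (simp add: sieved_averaging_add sieved_averaging_smult sieved_averaging_chebyshev_T)
  ultimately show ?thesis by (simp add: s_def coeff_chebyshev_T)
qed

lemma poly_chebyshev_T_1: "poly (chebyshev_T n) 1 = 1"
  using chebyshev_T_cos[of n 0] by simp

lemma poly_sieved_averaging_1: "poly (sieved_averaging k p) 1 = poly p (cos_pt k)"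
  by (induction p rule: poly_chebyshev_induct)
    (auto simp: sieved_averaging_0 sieved_averaging_add sieved_averaging_smult
      sieved_averaging_chebyshev_T poly_chebyshev_T_1)

lemma sieved_averaging_one: "sieved_averaging 1 p = p"
  by (induction p rule: poly_chebyshev_induct)
    (auto simp: sieved_averaging_0 sieved_averaging_add sieved_averaging_smult
      sieved_averaging_chebyshev_T poly_chebyshev_T_1 cos_pt_def)

lemma cos_pt_eq:
  assumes "k \<ge> 2"
  shows "cos_pt k = cos (pi / real k)"
proof -
  have "0 \<le> cos (pi / real k)"
    using assms by (intro cos_ge_zero) (auto simp: field_simps intro: order_trans[of _ 0])
  then show ?thesis by (simp add: cos_pt_def)
qed

lemma poly_chebyshev_T_cos_pt:
  "k \<ge> 2 \<Longrightarrow> poly (chebyshev_T n) (cos_pt k) = cos (real n * (pi / real k))"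
  by (simp add: cos_pt_eq chebyshev_T_cos)

text \<open>For \<open>p = T\<^sub>n\<close> this is the addition theorem for the cosine.\<close>

lemma sieved_averaging_shift:
  assumes "k \<ge> 2"
  shows "poly (sieved_averaging k p) (cos \<theta>) =
    (poly p (cos (\<theta> + pi / real k)) + poly p (cos (\<theta> - pi / real k))) / 2"
proof (induction p rule: poly_chebyshev_induct)
  case (chebyshev j)
  have "cos (real j * (\<theta> + pi / real k)) + cos (real j * (\<theta> - pi / real k))
      = 2 * (cos (real j * (pi / real k)) * cos (real j * \<theta>))"
    unfolding distrib_left right_diff_distrib cos_add cos_diff by simp
  then show ?case
    using poly_chebyshev_T_cos_pt[OF assms, of j]
    by (simp add: sieved_averaging_chebyshev_T chebyshev_T_cos del: times_divide_eq_right)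
qed (auto simp: sieved_averaging_0 sieved_averaging_add sieved_averaging_smult field_simps)

text \<open>The difference of the two values is \<open>2 sin ((m + 1) \<phi>) sin \<phi>\<close> with \<open>\<phi> = \<pi> / k\<close>; this is where
  divisibility by \<open>k\<close> enters.\<close>

lemma chebyshev_T_cos_pt_distinct:
  assumes "k \<ge> 2" "\<not> k dvd Suc m"
  shows "poly (chebyshev_T m) (cos_pt k) \<noteq> poly (chebyshev_T (m + 2)) (cos_pt k)"
proof -
  let ?\<phi> = "pi / real k"
  have 1: "sin (real (Suc m) * ?\<phi>) \<noteq> 0"
  proof
    assume "sin (real (Suc m) * ?\<phi>) = 0"
    then obtain i :: int where "real (Suc m) * ?\<phi> = of_int i * pi"
      using sin_zero_iff_int2 by blast
    then have "real (Suc m) = of_int i * real k"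
      using assms by (simp add: field_simps del: of_nat_Suc)
    then have "real_of_int (int (Suc m)) = of_int (i * int k)" by simp
    then have "int (Suc m) = i * int k" unfolding of_int_eq_iff .
    then have "int k dvd int (Suc m)" by simp
    then show False using assms(2) by (simp only: int_dvd_int_iff)
  qed
  have 2: "sin ?\<phi> \<noteq> 0"
    using assms sin_gt_zero[of ?\<phi>] by (simp add: field_simps)
  have "real m * x = real (Suc m) * x - x" "real (m + 2) * x = real (Suc m) * x + x" for x
    by (simp_all add: algebra_simps)
  then have "cos (real m * ?\<phi>) - cos (real (m + 2) * ?\<phi>) = 2 * (sin (real (Suc m) * ?\<phi>) * sin ?\<phi>)"
    by (simp only: cos_add cos_diff)
  then show ?thesis
    using 1 2 poly_chebyshev_T_cos_pt[OF assms(1)] by (metis eq_iff_diff_eq_0 mult_eq_0_iff zero_neq_numeral)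
qed

section \<open>Orthogonality\<close>

lemma AE_measure_support:
  fixes \<mu> :: "'a::second_countable_topology measure"
  assumes "sets \<mu> = sets borel"
  shows "AE x in \<mu>. x \<in> measure_support \<mu>"
proof -
  obtain B :: "'a set set" where B: "countable B" "topological_basis B"
    using ex_countable_basis by blast
  have "(\<Union>b\<in>{b\<in>B. emeasure \<mu> b = 0}. b) \<in> null_sets \<mu>"
    using B assms by (intro null_sets_UN') (auto intro!: null_setsI dest: topological_basis_open)
  moreover have "{x \<in> space \<mu>. x \<notin> measure_support \<mu>} \<subseteq> (\<Union>b\<in>{b\<in>B. emeasure \<mu> b = 0}. b)"
  proof
    fix x assume "x \<in> {x \<in> space \<mu>. x \<notin> measure_support \<mu>}"
    then obtain U where U: "open U" "x \<in> U" "emeasure \<mu> U = 0"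
      by (auto simp: measure_support_def zero_less_iff_neq_zero)
    then obtain b where b: "b \<in> B" "x \<in> b" "b \<subseteq> U"
      using topological_basisE[OF B(2)] by metis
    have "emeasure \<mu> b \<le> emeasure \<mu> U"
      using U b assms by (intro emeasure_mono) auto
    then show "x \<in> (\<Union>b\<in>{b\<in>B. emeasure \<mu> b = 0}. b)"
      using U b by auto
  qed
  ultimately show ?thesis by (rule AE_I')
qed

lemma integrable_poly:
  assumes "orthogonalization_measure \<mu>"
  shows "integrable \<mu> (poly p)"
proof -
  interpret prob_space \<mu> using assms by (simp add: orthogonalization_measure_def)
  have s: "sets \<mu> = sets borel" "measure_support \<mu> \<subseteq> {-1..1}"
    using assms by (auto simp: orthogonalization_measure_def)
  have "compact (poly p ` {-1..1})"
    by (intro compact_continuous_image continuous_intros compact_Icc)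
  then obtain C where C: "\<And>x. x \<in> {-1..1} \<Longrightarrow> norm (poly p x) \<le> C"
    using compact_imp_bounded bounded_iff by (metis imageI)
  have "AE x in \<mu>. norm (poly p x) \<le> C"
    using AE_measure_support[OF s(1)] by eventually_elim (use C s(2) in blast)
  moreover have "poly p \<in> borel_measurable \<mu>"
    unfolding measurable_cong_sets[OF s(1) refl]
    by (intro borel_measurable_continuous_onI continuous_intros)
  ultimately show ?thesis by (rule integrable_const_bound)
qed

lemma integrable_poly_mult:
  "orthogonalization_measure \<mu> \<Longrightarrow> integrable \<mu> (\<lambda>x. poly p x * poly q x)"
  using integrable_poly[of \<mu> "p * q"] by (simp add: poly_mult[abs_def])

text \<open>A polynomial of vanishing norm is zero almost everywhere; the open set where it does not
  vanish is then null, so the support would lie among its finitely many roots.\<close>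

lemma integral_poly_square_nonzero:
  assumes "orthogonalization_measure \<mu>" "p \<noteq> 0"
  shows "(LINT x|\<mu>. poly p x * poly p x) \<noteq> 0"
proof
  assume "(LINT x|\<mu>. poly p x * poly p x) = 0"
  then have "AE x in \<mu>. poly p x * poly p x = 0"
    using integral_nonneg_eq_0_iff_AE[OF integrable_poly_mult[OF assms(1), of p p]] by simp
  then have ae: "AE x in \<mu>. \<not> poly p x \<noteq> 0" by eventually_elim simp
  have s: "sets \<mu> = sets borel" "infinite (measure_support \<mu>)"
    using assms by (auto simp: orthogonalization_measure_def)
  have sp: "space \<mu> = UNIV" using sets_eq_imp_space_eq[OF s(1)] by simp
  have op: "open {x. poly p x \<noteq> 0}"
    by (intro open_Collect_neq continuous_intros)
  then have m: "{x. poly p x \<noteq> 0} \<in> sets \<mu>" using s by simp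
  have "emeasure \<mu> {x. poly p x \<noteq> 0} = 0"
    using AE_iff_measurable[OF m] ae sp by simp
  then have "measure_support \<mu> \<subseteq> {x. poly p x = 0}"
    using op unfolding measure_support_def by force
  then show False
    using s(2) poly_roots_finite[OF assms(2)] finite_subset by blast
qed

context
  fixes \<mu> :: "real measure" and P :: "nat \<Rightarrow> real poly"
  assumes rw: "random_walk_polys \<mu> P"
begin

lemma orthogonalization_measure_rw: "orthogonalization_measure \<mu>"
  using rw by (simp add: random_walk_polys_def)

lemma degree_rw: "degree (P n) = n"
  using rw by (simp add: random_walk_polys_def)

lemma poly_1_rw: "poly (P n) 1 = 1"
  using rw by (simp add: random_walk_polys_def)

lemma nonzero_rw: "P n \<noteq> 0"
  using poly_1_rw[of n] by auto

lemma lead_rw: "coeff (P n) n \<noteq> 0"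
  using nonzero_rw degree_rw by (metis leading_coeff_0_iff)

lemmas integrable_rw = integrable_poly_mult[OF orthogonalization_measure_rw]

lemma integral_polys_below_rw:
  assumes "q \<in> polys_below n"
  shows "(LINT x|\<mu>. poly q x * poly (P n) x) = 0"
  using assms
proof (induction rule: polys_below_induct[where B = P])
  case (add p q)
  then show ?case by (simp add: distrib_right integrable_rw)
next
  case (smult s p)
  then show ?case by (simp add: mult.assoc)
next
  case (basis j)
  then show ?case using rw by (simp add: random_walk_polys_def)
qed (auto simp: degree_rw lead_rw)

lemma integral_chebyshev_T_rw: "(LINT x|\<mu>. poly (chebyshev_T n) x * poly (P n) x) \<noteq> 0"
proof -
  define s where "s = coeff (chebyshev_T n) n / coeff (P n) n"
  define r where "r = chebyshev_T n - smult s (P n)"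
  have "s \<noteq> 0" by (simp add: s_def coeff_chebyshev_T lead_rw)
  have r: "r \<in> polys_below n"
    unfolding r_def s_def
    by (intro polys_below_lead) (auto simp: chebyshev_T_polys_below degree_rw lead_rw)
  have "chebyshev_T n = r + smult s (P n)" by (simp add: r_def)
  then have "(LINT x|\<mu>. poly (chebyshev_T n) x * poly (P n) x)
      = (LINT x|\<mu>. poly r x * poly (P n) x + s * (poly (P n) x * poly (P n) x))"
    by (simp add: distrib_right mult.assoc)
  also have "\<dots> = s * (LINT x|\<mu>. poly (P n) x * poly (P n) x)"
    by (simp add: integrable_rw integral_polys_below_rw[OF r])
  finally show ?thesis
    using \<open>s \<noteq> 0\<close> integral_poly_square_nonzero[OF orthogonalization_measure_rw nonzero_rw] by simp
qed

section \<open>Vanishing integrals force sievedness\<close>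

text \<open>After subtracting the multiple of \<open>P\<^sub>m\<^sub>+\<^sub>2\<close> that cancels the leading term of \<open>A\<^sub>k P\<^sub>m\<^sub>+\<^sub>2\<close>, only a
  multiple of \<open>T\<^sub>m\<close> and terms of degree below \<open>m\<close> remain.\<close>

lemma alpha_expansion:
  assumes "P (m + 2) - smult p (chebyshev_T (m + 2) + smult b (chebyshev_T m)) \<in> polys_below m"
  shows "alpha \<mu> P k (m + 2) m =
    p * b * (poly (chebyshev_T m) (cos_pt k) - poly (chebyshev_T (m + 2)) (cos_pt k)) *
    (LINT x|\<mu>. poly (chebyshev_T m) x * poly (P m) x)"
proof -
  define R where "R = P (m + 2) - smult p (chebyshev_T (m + 2) + smult b (chebyshev_T m))"
  define l0 where "l0 = poly (chebyshev_T m) (cos_pt k)"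
  define l2 where "l2 = poly (chebyshev_T (m + 2)) (cos_pt k)"
  define R' where "R' = sieved_averaging k R - smult l2 R"
  have "R \<in> polys_below m" using assms by (simp only: R_def)
  then have R': "R' \<in> polys_below m"
    unfolding R'_def by (intro polys_below_diff polys_below_smult sieved_averaging_polys_below)
  have P: "P (m + 2) = smult p (chebyshev_T (m + 2)) + smult (p * b) (chebyshev_T m) + R"
    by (simp add: R_def smult_add_right)
  have "sieved_averaging k (P (m + 2)) = smult (p * l2) (chebyshev_T (m + 2))
      + smult (p * b * l0) (chebyshev_T m) + sieved_averaging k R"
    unfolding P sieved_averaging_add sieved_averaging_smult sieved_averaging_chebyshev_T
    by (simp add: l0_def l2_def)
  also have "\<dots> = smult l2 (P (m + 2)) + smult (p * b * (l0 - l2)) (chebyshev_T m) + R'"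
    unfolding P R'_def by (simp add: smult_add_right algebra_simps smult_diff_left)
  finally have "alpha \<mu> P k (m + 2) m = (LINT x|\<mu>. l2 * (poly (P (m + 2)) x * poly (P m) x)
      + p * b * (l0 - l2) * (poly (chebyshev_T m) x * poly (P m) x) + poly R' x * poly (P m) x)"
    unfolding alpha_def by (simp add: distrib_right mult.assoc)
  also have "\<dots> = l2 * (LINT x|\<mu>. poly (P (m + 2)) x * poly (P m) x)
      + p * b * (l0 - l2) * (LINT x|\<mu>. poly (chebyshev_T m) x * poly (P m) x)"
    by (simp add: integrable_rw integral_polys_below_rw[OF R'])
  also have "(LINT x|\<mu>. poly (P (m + 2)) x * poly (P m) x) = 0"
    using rw by (simp add: random_walk_polys_def)
  finally show ?thesis by (simp add: l0_def l2_def)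
qed

context
  fixes c :: "nat \<Rightarrow> real"
  assumes rec: "recurrence_coeffs P c"
begin

lemma recurrence_rw: "[:0, 1:] * P n = smult (1 - c n) (P (n + 1)) + smult (c n) (P (n - 1))"
  using rec by (simp add: recurrence_coeffs_def)

lemma coeff_range_rw: "c n < 1"
  using rec unfolding recurrence_coeffs_def by (cases "n = 0") auto

lemma initial_rw: "P 0 = 1" "P 1 = [:0, 1:]"
  using rec recurrence_rw[of 0] by (auto simp: recurrence_coeffs_def)

text \<open>The second Chebyshev coefficient is propagated by the three-term recurrence. The exception at
  \<open>m = 0\<close> is due to \<open>x T\<^sub>0 = T\<^sub>1\<close>, where the factor \<open>1/2\<close> of the generic case is absent.\<close>

lemma chebyshev_expansion_step:
  assumes R1: "P (m + 1) - smult (2 * a * p) (chebyshev_T (m + 1)) \<in> polys_below (m + 1)"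
    and R2: "P (m + 2) - smult p (chebyshev_T (m + 2) + smult b (chebyshev_T m)) \<in> polys_below m"
    and "m = 0 \<Longrightarrow> b = 0"
  shows "P (m + 3) - smult (p / (2 * (1 - c (m + 2)))) (chebyshev_T (m + 3)
    + smult (1 + b - 4 * a * c (m + 2)) (chebyshev_T (m + 1))) \<in> polys_below (m + 1)"
    (is "P (m + 3) - smult ?p' (_ + smult ?b' _) \<in> _")
proof -
  define d where "d = c (m + 2)"
  have d: "1 - d \<noteq> 0" using coeff_range_rw[of "m + 2"] by (simp add: d_def)
  define r1 where "r1 = P (m + 1) - smult (2 * a * p) (chebyshev_T (m + 1))"
  define r2 where "r2 = P (m + 2) - smult p (chebyshev_T (m + 2) + smult b (chebyshev_T m))"
  define X where "X = chebyshev_T (m + 3) + smult (1 + b - 4 * a * d) (chebyshev_T (m + 1))"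
  define r0 where "r0 = smult b ([:0, 1:] * chebyshev_T m - smult (1/2) (chebyshev_T (m + 1)))"
  define Y where "Y = smult p r0 + [:0, 1:] * r2 - smult d r1"
  have r0: "r0 \<in> polys_below (m + 1)"
  proof (cases m)
    case 0
    then show ?thesis using assms(3) by (simp add: r0_def zero_in_polys_below)
  next
    case (Suc n)
    have "[:0, 1:] * chebyshev_T m - smult (1/2) (chebyshev_T (m + 1)) = smult (1/2) (chebyshev_T n)"
      unfolding Suc mult_x_chebyshev_T by (simp add: smult_add_right)
    then show ?thesis
      unfolding r0_def by (auto simp: Suc intro!: polys_below_smult chebyshev_T_polys_below)
  qed
  have xT: "[:0, 1:] * chebyshev_T m * [:b:] = r0 + smult (b/2) (chebyshev_T (m + 1))"
    by (simp add: r0_def smult_diff_right algebra_simps)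
  have P2: "P (m + 2) = smult p (chebyshev_T (m + 2)) + smult p ([:b:] * chebyshev_T m) + r2"
    by (simp add: r2_def smult_add_right)
  have P1: "P (m + 1) = smult (2 * a * p) (chebyshev_T (m + 1)) + r1"
    by (simp add: r1_def)
  have "smult (1 - d) (P (m + 3)) = [:0, 1:] * P (m + 2) - smult d (P (m + 1))"
    using recurrence_rw[of "m + 2"] by (simp add: d_def numeral_3_eq_3)
  also have "\<dots> = smult p ([:0, 1:] * chebyshev_T (Suc (m + 1)))
      + smult p ([:0, 1:] * chebyshev_T m * [:b:])
      + [:0, 1:] * r2 - smult d (smult (2 * a * p) (chebyshev_T (m + 1)) + r1)"
    unfolding P1 P2 by (simp add: algebra_simps)
  also have "\<dots> = smult (p / 2) X + Y"
    unfolding mult_x_chebyshev_T xT X_def Y_def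
    by (rule poly_eqI) (simp add: numeral_3_eq_3 field_simps)
  finally have "smult (inverse (1 - d)) (smult (1 - d) (P (m + 3)))
      = smult (inverse (1 - d)) (smult (p / 2) X + Y)"
    by (rule arg_cong)
  moreover have "inverse (1 - d) * (1 - d) = 1" "inverse (1 - d) * (p / 2) = p / (2 * (1 - d))"
    using d by (simp_all add: field_simps)
  ultimately have "P (m + 3) = smult (p / (2 * (1 - d))) X + smult (inverse (1 - d)) Y"
    by (simp only: smult_add_right smult_smult smult_1_left)
  then have "P (m + 3) - smult ?p' X = smult (inverse (1 - d)) Y"
    by (simp add: d_def)
  moreover have "Y \<in> polys_below (m + 1)"
    using r0 R1 polys_below_mult_x[OF R2] unfolding Y_def r1_def[symmetric] r2_def[symmetric]
    by (auto intro!: polys_below_diff polys_below_add polys_below_smult)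
  ultimately show ?thesis by (simp add: X_def d_def polys_below_smult)
qed

text \<open>The expansions of two consecutive polynomials and the sieving condition are carried along
  together: the value \<open>1 - 2 c\<^sub>m\<^sub>+\<^sub>1\<close> of the second coefficient is only obtained because of the
  instances of the sieving condition proved before. At indices not divisible by \<open>k\<close> that
  coefficient is \<open>0\<close>; at a multiple of \<open>k\<close> the preceding recurrence coefficient is \<open>1/2\<close>.\<close>

lemma chebyshev_expansion_if_alpha_zero:
  assumes k: "k \<ge> 2" and alpha: "\<And>m. alpha \<mu> P k (m + 2) m = 0"
  shows "\<exists>p. p \<noteq> 0 \<and>
    P (m + 1) - smult (2 * (1 - c (m + 1)) * p) (chebyshev_T (m + 1)) \<in> polys_below (m + 1) \<and>
    P (m + 2) - smult p (chebyshev_T (m + 2) + smult (1 - 2 * c (m + 1)) (chebyshev_T m))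
      \<in> polys_below m \<and>
    (\<not> k dvd m + 1 \<longrightarrow> c (m + 1) = 1 / 2)"
proof -
  have zero: "b = 0"
    if "p \<noteq> 0" "\<not> k dvd Suc m"
      "P (m + 2) - smult p (chebyshev_T (m + 2) + smult b (chebyshev_T m)) \<in> polys_below m" for p b m
    using alpha_expansion[OF that(3), of k] alpha[of m] integral_chebyshev_T_rw[of m]
      chebyshev_T_cos_pt_distinct[OF k that(2)] that(1) by simp
  show ?thesis
  proof (induction m)
    case 0
    define p where "p = 1 / (2 * (1 - c 1))"
    have c1: "1 - c 1 \<noteq> 0" using coeff_range_rw[of 1] by simp
    then have p: "p \<noteq> 0" "2 * (1 - c 1) * p = 1" by (auto simp: p_def)
    have T2: "chebyshev_T 2 = [:-1, 0, 2:]"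
      by (simp add: numeral_2_eq_2 chebyshev_T_rec one_pCons)
    have "[:0, 0, 1:] = smult (1 - c 1) (P 2) + [:c 1:]"
      using recurrence_rw[of 1] initial_rw by (simp add: numeral_2_eq_2)
    from arg_cong[OF this, of "\<lambda>q. q - [:c 1:]"]
    have "smult (1 - c 1) (P 2) = [:- c 1, 0, 1:]" by simp
    moreover have "(1 - c 1) * p = 1 / 2" using p(2) by (simp add: algebra_simps)
    ultimately have "smult (1 - c 1) (P 2) = smult (1 - c 1) (smult p [:- 2 * c 1, 0, 2:])"
      by (simp only: smult_smult) simp
    then have "P 2 = smult p [:- 2 * c 1, 0, 2:]"
      using c1 by (metis smult_cancel)
    then have P2: "P 2 - smult p (chebyshev_T 2 + smult (1 - 2 * c 1) (chebyshev_T 0)) \<in> polys_below 0"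
      by (simp add: polys_below_0 T2 chebyshev_T_rec smult_add_right one_pCons)
    moreover have "P 1 - smult (2 * (1 - c 1) * p) (chebyshev_T 1) \<in> polys_below 1"
      using p initial_rw by (simp add: chebyshev_T_rec zero_in_polys_below)
    moreover have "c 1 = 1 / 2" if "\<not> k dvd 1"
      using zero[of p 0 "1 - 2 * c 1"] p that P2 by (simp add: numeral_2_eq_2)
    ultimately show ?case unfolding add_0 using p(1) by blast
  next
    case (Suc m)
    then obtain p where p: "p \<noteq> 0"
      and P1: "P (m + 1) - smult (2 * (1 - c (m + 1)) * p) (chebyshev_T (m + 1)) \<in> polys_below (m + 1)"
      and P2: "P (m + 2) - smult p (chebyshev_T (m + 2) + smult (1 - 2 * c (m + 1)) (chebyshev_T m))
        \<in> polys_below m"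
      and s: "\<not> k dvd m + 1 \<longrightarrow> c (m + 1) = 1 / 2" by blast
    define p' where "p' = p / (2 * (1 - c (m + 2)))"
    have d: "1 - c (m + 2) \<noteq> 0" using coeff_range_rw[of "m + 2"] by simp
    define b where "b = 2 * (1 - c (m + 1)) * (1 - 2 * c (m + 2))"
    have b: "1 + (1 - 2 * c (m + 1)) - 4 * (1 - c (m + 1)) * c (m + 2) = b"
      by (simp add: b_def algebra_simps)
    have p': "p' \<noteq> 0" "2 * (1 - c (m + 2)) * p' = p" using p d by (auto simp: p'_def)
    have "1 - 2 * c (m + 1) = 0" if "m = 0"
      using that s k by simp
    from chebyshev_expansion_step[OF P1 P2 this]
    have P3: "P (m + 3) - smult p' (chebyshev_T (m + 3) + smult b (chebyshev_T (m + 1)))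
        \<in> polys_below (m + 1)"
      unfolding b p'_def .
    have b0: "b = 0" if "\<not> k dvd m + 2"
      using zero[OF p'(1), of "m + 1" b] that P3 by (simp add: numeral_3_eq_3)
    have c2: "c (m + 2) = 1 / 2" if "\<not> k dvd m + 2"
      using b0[OF that] coeff_range_rw[of "m + 1"] by (simp add: b_def)
    have "b = 1 - 2 * c (m + 2)"
    proof (cases "k dvd m + 2")
      case True
      then have "\<not> k dvd m + 1"
        using k dvd_diff_nat[of k "m + 2" "m + 1"] by auto
      then show ?thesis using s by (simp add: b_def)
    next
      case False
      then show ?thesis using c2 b0 by simp
    qed
    moreover have "P (m + 2) - smult p (chebyshev_T (m + 2)) \<in> polys_below (m + 2)"
    proof -
      have "P (m + 2) - smult p (chebyshev_T (m + 2))
        = (P (m + 2) - smult p (chebyshev_T (m + 2) + smult (1 - 2 * c (m + 1)) (chebyshev_T m)))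
          + smult (p * (1 - 2 * c (m + 1))) (chebyshev_T m)"
        by (simp add: smult_add_right)
      also have "\<dots> \<in> polys_below (m + 2)"
        by (intro polys_below_add polys_below_mono[OF P2] polys_below_smult chebyshev_T_polys_below) auto
      finally show ?thesis .
    qed
    moreover have "Suc m + 1 = m + 2" "Suc m + 2 = m + 3" "Suc m = m + 1" by simp_all
    ultimately show ?case
      using p' P3 c2 by metis
  qed
qed

lemma k_sieved_if_alpha_zero:
  assumes k: "k \<ge> 1" and alpha: "\<And>m. alpha \<mu> P k (m + 2) m = 0"
  shows "k_sieved k c"
proof (cases "k = 1")
  case False
  with k have "k \<ge> 2" by simp
  have "c n = 1 / 2" if "n \<ge> 1" "\<not> k dvd n" for n
    using chebyshev_expansion_if_alpha_zero[OF \<open>k \<ge> 2\<close> alpha, of "n - 1"] that by auto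
  then show ?thesis by (simp add: k_sieved_def)
qed (simp add: k_sieved_def)

section \<open>Sieved sequences consist of eigenvectors\<close>

lemma recurrence_cos:
  "cos \<theta> * poly (P n) (cos \<theta>) =
    (1 - c n) * poly (P (n + 1)) (cos \<theta>) + c n * poly (P (n - 1)) (cos \<theta>)"
  using arg_cong[OF recurrence_rw[of n], of "\<lambda>p. poly p (cos \<theta>)"] by simp

text \<open>With coefficients \<open>1/2\<close> the recurrence reads \<open>y\<^sub>j\<^sub>+\<^sub>1 = 2 cos \<theta> y\<^sub>j - y\<^sub>j\<^sub>-\<^sub>1\<close>, which is
  solved by \<open>cos (j \<theta>)\<close> and \<open>sin (j \<theta>)\<close>.\<close>

lemma harmonic_block:
  assumes half: "\<And>i. 1 \<le> i \<Longrightarrow> i < k \<Longrightarrow> c (N + i) = 1 / 2"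
    and "poly (P N) (cos \<theta>) = u"
    and "poly (P (N + 1)) (cos \<theta>) = u * cos \<theta> + v * sin \<theta>"
    and "j \<le> k"
  shows "poly (P (N + j)) (cos \<theta>) = u * cos (real j * \<theta>) + v * sin (real j * \<theta>)"
  using \<open>j \<le> k\<close>
proof (induction j rule: less_induct)
  case (less j)
  consider "j = 0" | "j = 1" | i where "j = Suc (Suc i)"
    by (metis One_nat_def old.nat.exhaust)
  then show ?case
  proof cases
    case (3 i)
    have "poly (P (N + j)) (cos \<theta>)
        = 2 * cos \<theta> * poly (P (N + Suc i)) (cos \<theta>) - poly (P (N + i)) (cos \<theta>)"
    proof -
      have "c (N + Suc i) = 1 / 2" using half[of "Suc i"] less.prems 3 by simp
      from recurrence_cos[of \<theta> "N + Suc i", unfolded this] show ?thesis by (simp add: 3)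
    qed
    also have "\<dots> = u * (2 * cos \<theta> * cos (real (Suc i) * \<theta>) - cos (real i * \<theta>))
        + v * (2 * cos \<theta> * sin (real (Suc i) * \<theta>) - sin (real i * \<theta>))"
      using less.IH[of "Suc i"] less.IH[of i] less.prems 3 by (simp add: algebra_simps)
    also have "2 * cos \<theta> * cos (real (Suc i) * \<theta>) - cos (real i * \<theta>) = cos (real j * \<theta>)"
      unfolding 3 cos_Suc_Suc ..
    also have "2 * cos \<theta> * sin (real (Suc i) * \<theta>) - sin (real i * \<theta>) = sin (real j * \<theta>)"
    proof -
      have "sin (real (Suc i) * \<theta> + \<theta>) + sin (real (Suc i) * \<theta> - \<theta>)
          = 2 * cos \<theta> * sin (real (Suc i) * \<theta>)"
        by (simp add: sin_add sin_diff)
      then show ?thesis by (simp add: 3 algebra_simps)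
    qed
    finally show ?thesis .
  qed (use assms in simp_all)
qed

text \<open>If \<open>u'\<close> and \<open>v'\<close> belong to the next block, then \<open>u'\<close> is the value of the old block at its right
  end. The value just before it is \<open>u' cos \<theta> + w sin \<theta>\<close> with \<open>w = u sin (k \<theta>) - v cos (k \<theta>)\<close>, and
  the recurrence across the end, where the coefficient is arbitrary, turns \<open>w\<close> into a multiple.\<close>

lemma sieved_block:
  assumes k: "k \<ge> 1" and sieved: "k_sieved k c"
  shows "\<exists>u v. (\<forall>\<theta>. u (\<theta> + pi / real k) = (-1) ^ m * u \<theta>) \<and>
    (\<forall>\<theta>. v (\<theta> + pi / real k) = (-1) ^ m * v \<theta>) \<and>
    (\<forall>j\<le>k. \<forall>\<theta>. poly (P (m * k + j)) (cos \<theta>) = u \<theta> * cos (real j * \<theta>) + v \<theta> * sin (real j * \<theta>))"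
proof -
  have half: "c (m * k + i) = 1 / 2" if "1 \<le> i" "i < k" for m i
  proof -
    have "\<not> k dvd m * k + i"
      using that by (metis dvd_add_right_iff dvd_imp_le dvd_triv_right less_le_not_le not_one_le_zero
          bot_nat_0.not_eq_extremum)
    then show ?thesis using sieved that by (simp add: k_sieved_def)
  qed
  show ?thesis
  proof (induction m)
    case 0
    have "poly (P (0 * k + j)) (cos \<theta>) = 1 * cos (real j * \<theta>) + 0 * sin (real j * \<theta>)"
      if "j \<le> k" for j \<theta>
      using harmonic_block[of k "0 * k" \<theta> 1 0 j, OF half] initial_rw that by simp
    then show ?case by (intro exI[of _ "\<lambda>_. 1"] exI[of _ "\<lambda>_. 0"]) auto
  next
    case (Suc m)
    then obtain u v where u: "\<And>\<theta>. u (\<theta> + pi / real k) = (-1) ^ m * u \<theta>"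
      and v: "\<And>\<theta>. v (\<theta> + pi / real k) = (-1) ^ m * v \<theta>"
      and P: "\<And>j \<theta>. j \<le> k \<Longrightarrow>
        poly (P (m * k + j)) (cos \<theta>) = u \<theta> * cos (real j * \<theta>) + v \<theta> * sin (real j * \<theta>)"
      by blast
    define N where "N = Suc m * k"
    define u' where "u' \<theta> = u \<theta> * cos (real k * \<theta>) + v \<theta> * sin (real k * \<theta>)" for \<theta>
    define w where "w \<theta> = u \<theta> * sin (real k * \<theta>) - v \<theta> * cos (real k * \<theta>)" for \<theta>
    define v' where "v' \<theta> = - (c N / (1 - c N)) * w \<theta>" for \<theta>
    have a: "1 - c N \<noteq> 0" using coeff_range_rw[of N] by simp
    have k\<phi>: "real k * (\<theta> + pi / real k) = real k * \<theta> + pi" for \<theta>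
      using k by (simp add: field_simps)
    have u': "u' (\<theta> + pi / real k) = (-1) ^ Suc m * u' \<theta>" for \<theta>
      unfolding u'_def k\<phi> u v by (simp add: algebra_simps)
    have w: "w (\<theta> + pi / real k) = (-1) ^ Suc m * w \<theta>" for \<theta>
      unfolding w_def k\<phi> u v by (simp add: algebra_simps)
    have v': "v' (\<theta> + pi / real k) = (-1) ^ Suc m * v' \<theta>" for \<theta>
      unfolding v'_def w by simp
    have P0: "poly (P N) (cos \<theta>) = u' \<theta>" for \<theta>
      using P[of k \<theta>] by (simp add: N_def u'_def add.commute)
    have Pm: "poly (P (N - 1)) (cos \<theta>) = u' \<theta> * cos \<theta> + w \<theta> * sin \<theta>" for \<theta>
    proof -
      have N1: "N - 1 = m * k + (k - 1)" using k by (simp add: N_def)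
      have r: "real (k - 1) * \<theta> = real k * \<theta> - \<theta>" using k by (simp add: of_nat_diff algebra_simps)
      have "poly (P (N - 1)) (cos \<theta>) = u \<theta> * cos (real k * \<theta> - \<theta>) + v \<theta> * sin (real k * \<theta> - \<theta>)"
        unfolding N1 using P[of "k - 1" \<theta>] r by simp
      then show ?thesis by (simp add: u'_def w_def cos_diff sin_diff algebra_simps)
    qed
    have P1: "poly (P (N + 1)) (cos \<theta>) = u' \<theta> * cos \<theta> + v' \<theta> * sin \<theta>" for \<theta>
    proof -
      have "(1 - c N) * poly (P (N + 1)) (cos \<theta>)
          = cos \<theta> * u' \<theta> - c N * (u' \<theta> * cos \<theta> + w \<theta> * sin \<theta>)"
        using recurrence_cos[of \<theta> N] unfolding P0 Pm by simp
      also have "\<dots> = (1 - c N) * (u' \<theta> * cos \<theta> + v' \<theta> * sin \<theta>)"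
        using a by (simp add: v'_def field_simps)
      finally show ?thesis using a by simp
    qed
    have "poly (P (N + j)) (cos \<theta>) = u' \<theta> * cos (real j * \<theta>) + v' \<theta> * sin (real j * \<theta>)"
      if "j \<le> k" for j \<theta>
      using harmonic_block[of k N \<theta> "u' \<theta>" "v' \<theta>" j] half[of _ "Suc m"] P0 P1 that
      by (simp add: N_def)
    then show ?case using u' v' unfolding N_def by blast
  qed
qed

lemma sieved_imp_eigenvector:
  assumes k: "k \<ge> 1" and sieved: "k_sieved k c"
  shows "\<exists>l. eigenpair (sieved_averaging k) l (P n)"
proof (cases "k = 1")
  case True
  have "sieved_averaging 1 (P n) = smult 1 (P n)" by (simp only: sieved_averaging_one smult_1_left)
  then show ?thesis using True nonzero_rw unfolding eigenpair_def by blast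
next
  case False
  with k have k2: "k \<ge> 2" by simp
  define m where "m = n div k"
  define j where "j = n mod k"
  define \<phi> where "\<phi> = pi / real k"
  have n: "n = m * k + j" and j: "j \<le> k" using k by (auto simp: m_def j_def less_imp_le)
  obtain u v where u: "\<And>\<theta>. u (\<theta> + \<phi>) = (-1) ^ m * u \<theta>"
    and v: "\<And>\<theta>. v (\<theta> + \<phi>) = (-1) ^ m * v \<theta>"
    and P: "\<And>\<theta>. poly (P n) (cos \<theta>) = u \<theta> * cos (real j * \<theta>) + v \<theta> * sin (real j * \<theta>)"
    using sieved_block[OF k sieved, of m] j unfolding n \<phi>_def by blast
  \<comment> \<open>The factor for the opposite shift is the inverse of \<open>(-1) ^ m\<close>, which is \<open>(-1) ^ m\<close> again.\<close>
  have um: "u (\<theta> - \<phi>) = (-1) ^ m * u \<theta>" and vm: "v (\<theta> - \<phi>) = (-1) ^ m * v \<theta>" for \<theta>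
    using u[of "\<theta> - \<phi>"] v[of "\<theta> - \<phi>"] by (cases "even m"; simp)+
  have "sieved_averaging k (P n) = smult ((-1) ^ m * cos (real j * \<phi>)) (P n)"
  proof (rule poly_eqI_cos)
    fix \<theta>
    have "poly (sieved_averaging k (P n)) (cos \<theta>)
        = (poly (P n) (cos (\<theta> + \<phi>)) + poly (P n) (cos (\<theta> - \<phi>))) / 2"
      unfolding \<phi>_def by (rule sieved_averaging_shift[OF k2])
    also have "\<dots> = (-1) ^ m * cos (real j * \<phi>) * poly (P n) (cos \<theta>)"
      unfolding P u v um vm
      unfolding distrib_left right_diff_distrib cos_add cos_diff sin_add sin_diff
      by (simp add: field_simps)
    finally show "poly (sieved_averaging k (P n)) (cos \<theta>)
        = poly (smult ((-1) ^ m * cos (real j * \<phi>)) (P n)) (cos \<theta>)" by simp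
  qed
  then show ?thesis using nonzero_rw unfolding eigenpair_def by blast
qed

end

section \<open>Eigenvalues\<close>

lemma eigenvalue_rw:
  assumes "eigenpair (sieved_averaging k) l (P n)"
  shows "poly (P n) (cos_pt k) = l" "poly (chebyshev_T n) (cos_pt k) = l"
proof -
  have A: "sieved_averaging k (P n) = smult l (P n)" using assms by (simp add: eigenpair_def)
  show "poly (P n) (cos_pt k) = l"
    using poly_sieved_averaging_1[of k "P n"] A poly_1_rw by simp
  show "poly (chebyshev_T n) (cos_pt k) = l"
    using coeff_sieved_averaging[OF degree_rw, of k n] A lead_rw by simp
qed

lemma alpha_eigenvector:
  assumes "eigenpair (sieved_averaging k) l (P n)" "n \<noteq> j"
  shows "alpha \<mu> P k n j = 0"
  using assms rw by (simp add: alpha_def eigenpair_def random_walk_polys_def mult.assoc)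

end

theorem theorem3p1:
  fixes \<mu> :: "real measure" and P :: "nat \<Rightarrow> real poly" and c :: "nat \<Rightarrow> real" and k :: nat
  assumes "random_walk_polys \<mu> P"
    and "recurrence_coeffs P c"
    and "k \<ge> 1"
  shows "(k_sieved k c \<longleftrightarrow> (\<forall>n. \<exists>l. eigenpair (sieved_averaging k) l (P n))) \<and>
         (k_sieved k c \<longleftrightarrow> (\<forall>n\<ge>1. alpha \<mu> P k (n + 1) (n - 1) = 0)) \<and>
         (k_sieved k c \<longrightarrow>
            (\<forall>n. poly (P n) (cos_pt k) = poly (chebyshev_T n) (cos_pt k) \<and>
                 eigenpair (sieved_averaging k) (poly (P n) (cos_pt k)) (P n)))"
proof -
  let ?i = "k_sieved k c" and ?ii = "\<forall>n. \<exists>l. eigenpair (sieved_averaging k) l (P n)"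
  let ?iii = "\<forall>n\<ge>1. alpha \<mu> P k (n + 1) (n - 1) = 0"
  have 1: "?ii" if ?i
    using sieved_imp_eigenvector[OF assms that] by blast
  have 2: "?iii" if ?ii
  proof (intro allI impI)
    fix n :: nat assume "n \<ge> 1"
    from \<open>?ii\<close> obtain l where "eigenpair (sieved_averaging k) l (P (n + 1))" by blast
    then show "alpha \<mu> P k (n + 1) (n - 1) = 0"
      by (rule alpha_eigenvector[OF assms(1)]) simp
  qed
  have 3: "?i" if ?iii
  proof (rule k_sieved_if_alpha_zero[OF assms])
    fix m show "alpha \<mu> P k (m + 2) m = 0" using that[rule_format, of "m + 1"] by simp
  qed
  have 4: "poly (P n) (cos_pt k) = poly (chebyshev_T n) (cos_pt k) \<and>
      eigenpair (sieved_averaging k) (poly (P n) (cos_pt k)) (P n)" if ?i for n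
    using 1[OF that] eigenvalue_rw[OF assms(1)] by metis
  show ?thesis using 1 2 3 4 by blast
qed

end
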